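(* Let $k_n^{\#1}$ be the number of rows with the value true in the truth tables of all the bracketed m-implications with $n$ variables, type 2, case 1. Then, as $n\to\infty$, $$k_n^{\#1} \sim \left(\frac{\sqrt{2}}{2}\right)\frac{2^{3n-2}}{\sqrt{\pi n^3}}.$$
   Context: The m-implication of type 2 is the connective $\psi\leftharpoonup\phi\equiv\neg\psi\to\phi$, which has value 0 (false) exactly when $\psi$ and $\phi$ both have value 0, and value 1 (true) otherwise. A bracketed formula with $n$ distinct variables is obtained from $p_1\leftharpoonup p_2\leftharpoonup\cdots\leftharpoonup p_n$ (variables in this fixed order) by fully inserting brackets; for $n\ge2$ it has the form $\psi\leftharpoonup\phi$ with $\psi$ a bracketing of $p_1\leftharpoonup\cdots\leftharpoonup p_i$ and $\phi$ a bracketing of $p_{i+1}\leftharpoonup\cdots\leftharpoonup p_n$ for some $1\le i\le n-1$. A row is a pair consisting of a bracketed formula and a valuation of $p_1,\dots,p_n$ in $\{0,1\}$. Case 1 means: for $n\ge2$, $k_n^{\#1}$ counts the rows (over all bracketed formulae in $n$ variables) for which $\psi$ and $\phi$ both have value 1 (so that $\psi\leftharpoonup\phi$ is true). $u_n\sim v_n$ means $u_n/v_n\to1$. *)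

theory Defs
  imports Complex_Main "HOL-Library.FuncSet" "HOL-Library.Landau_Symbols"
begin

text \<open>Formulae built from the variables \<open>p\<^sub>1, p\<^sub>2, \<dots>\<close> with the single connective
  \<open>\<leftharpoonup>\<close>, the m-implication of type 2.\<close>

datatype formula = Var nat | MImp formula formula (infix "\<leftharpoonup>" 65)

definition mimp2 :: "bool \<Rightarrow> bool \<Rightarrow> bool" where
  "mimp2 a b \<longleftrightarrow> (\<not> a \<longrightarrow> b)"

primrec truth :: "(nat \<Rightarrow> bool) \<Rightarrow> formula \<Rightarrow> bool" where
  "truth v (Var i) = v i"
| "truth v (\<psi> \<leftharpoonup> \<phi>) = mimp2 (truth v \<psi>) (truth v \<phi>)"

text \<open>\<open>bracketing i j \<chi>\<close>: the formula \<open>\<chi>\<close> arises by fully bracketing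
  \<open>p\<^sub>i \<leftharpoonup> p\<^sub>i\<^sub>+\<^sub>1 \<leftharpoonup> \<dots> \<leftharpoonup> p\<^sub>j\<close>. Both endpoints are included.\<close>

inductive bracketing :: "nat \<Rightarrow> nat \<Rightarrow> formula \<Rightarrow> bool" where
  single: "bracketing i i (Var i)"
| split: "\<lbrakk>i \<le> k; k < j; bracketing i k \<psi>; bracketing (k + 1) j \<phi>\<rbrakk>
    \<Longrightarrow> bracketing i j (\<psi> \<leftharpoonup> \<phi>)"

text \<open>Valuations of \<open>p\<^sub>1, \<dots>, p\<^sub>n\<close> are extensional functions on \<open>{1..n}\<close>, so that
  each of the \<open>2\<^sup>n\<close> valuations is counted once.\<close>

definition rows :: "nat \<Rightarrow> (formula \<times> (nat \<Rightarrow> bool)) set" where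
  "rows n = {\<chi>. bracketing 1 n \<chi>} \<times> ({1..n} \<rightarrow>\<^sub>E UNIV)"

text \<open>For \<open>n < 2\<close> the value is 0, since no bracketing then has the form
  \<open>\<psi> \<leftharpoonup> \<phi>\<close>.\<close>

definition k_case1 :: "nat \<Rightarrow> nat" where
  "k_case1 n = card {(\<chi>, v) \<in> rows n. \<exists>\<psi> \<phi>. \<chi> = \<psi> \<leftharpoonup> \<phi> \<and> truth v \<psi> \<and> truth v \<phi>}"

end

theory Submission
  imports Defs "HOL-Analysis.Gamma_Function" "HOL-Analysis.Generalised_Binomial_Theorem"
    "HOL-Real_Asymp.Real_Asymp"
begin

text \<open>
  A bracketed formula is true unless all its variables are false, so a split after the \<open>k\<close>-th
  variable contributes \<open>(2^k - 1) (2^(n-k) - 1)\<close> valuations per pair of bracketings. The number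
  of bracketings of \<open>n\<close> variables is \<open>-h n / 2\<close>, with \<open>h n\<close> the coefficients of \<open>sqrt (1 - 4 x)\<close>;
  this turns the count into \<open>-1/2\<close> times the \<open>n\<close>-th coefficient of
  \<open>sqrt (1 - 4 x) sqrt (1 - 8 x)\<close>. The dominant singularity is \<open>x = 1/8\<close>: divided by \<open>2^n h n\<close>, the
  convolution tends, by dominated convergence, to \<open>sqrt (1 - 4/8) = sqrt 2 / 2\<close>, while \<open>h n\<close> itself
  is a binomial coefficient with known asymptotics.
\<close>

section \<open>Coefficients of the power series of \<open>sqrt (1 - 4 x)\<close>\<close>

definition sqrt_coeff :: "nat \<Rightarrow> real" where
  "sqrt_coeff n = ((1/2) gchoose n) * (-4) ^ n"

lemma sqrt_coeff_0 [simp]: "sqrt_coeff 0 = 1"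
  by (simp add: sqrt_coeff_def)

lemma sqrt_coeff_1 [simp]: "sqrt_coeff (Suc 0) = -2"
  by (simp add: sqrt_coeff_def)

lemma sqrt_coeff_Suc: "sqrt_coeff (Suc n) = (4 * real n - 2) / (real n + 1) * sqrt_coeff n"
proof -
  have g: "((1/2::real) gchoose Suc n) = (1/2 - real n) / (real n + 1) * ((1/2) gchoose n)"
    using gbinomial_mult_1[of "1/2::real" n] by (simp add: field_simps)
  show ?thesis
    unfolding sqrt_coeff_def power_Suc g by (simp add: field_simps)
qed

text \<open>The coefficients later serve as denominators. The factor \<open>4 * real n - 2\<close>
  of the recurrence has no zero at a natural number.\<close>

lemma sqrt_coeff_nonzero: "sqrt_coeff n \<noteq> 0"
proof (induction n)
  case (Suc n)
  have "4 * real n - 2 \<noteq> 0"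
  proof
    assume "4 * real n - 2 = 0"
    then have "real (2 * n) = real 1" by simp
    then have "2 * n = 1" by (simp only: of_nat_eq_iff)
    then show False by presburger
  qed
  with Suc show ?case by (simp add: sqrt_coeff_Suc)
qed simp

text \<open>Squaring the series gives \<open>1 - 4 x\<close>, which has no terms of degree 2 or
  more; Vandermonde's identity is this fact read off coefficientwise.\<close>

lemma sqrt_coeff_convolution:
  assumes "n \<ge> 2"
  shows "(\<Sum>k\<le>n. sqrt_coeff k * sqrt_coeff (n - k)) = 0"
proof -
  have "(\<Sum>k\<le>n. sqrt_coeff k * sqrt_coeff (n - k)) =
      (\<Sum>k\<le>n. ((1/2) gchoose k) * ((1/2) gchoose (n - k)) * (-4) ^ n)"
    by (intro sum.cong) (simp_all add: sqrt_coeff_def flip: power_add)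
  also have "\<dots> = (1 gchoose n) * (-4) ^ n"
    using gbinomial_Vandermonde[of "1/2::real" "1/2" n]
    by (simp add: atLeast0AtMost flip: sum_distrib_right)
  also have "(1 gchoose n) = (0::real)"
    using assms binomial_gbinomial[of 1 n, where 'a = real] by (simp add: binomial_eq_0)
  finally show ?thesis by simp
qed

lemma sum_atMost_ends:
  fixes f :: "nat \<Rightarrow> real"
  assumes "n \<ge> 1"
  shows "(\<Sum>k\<le>n. f k) = f 0 + f n + (\<Sum>k\<in>{1..<n}. f k)"
proof -
  have "{..n} = insert 0 (insert n {1..<n})" using assms by auto
  then show ?thesis using assms by simp
qed

text \<open>Each of the two end terms of the vanishing convolution equals
  \<open>sqrt_coeff n\<close>. After scaling by \<open>-1/2\<close>, what remains is the Catalan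
  recurrence.\<close>

lemma sqrt_coeff_convolution_inner:
  assumes "n \<ge> 2"
  shows "(\<Sum>k\<in>{1..<n}. sqrt_coeff k * sqrt_coeff (n - k)) = -2 * sqrt_coeff n"
  using sqrt_coeff_convolution[OF assms] assms by (simp add: sum_atMost_ends)

section \<open>Bracketings: truth values and number\<close>

lemma bracketing_size: "bracketing i j \<xi> \<Longrightarrow> i \<le> j \<and> size \<xi> = j - i"
  by (induction rule: bracketing.induct) auto

text \<open>The connective is disjunction in disguise, so the placement of brackets does not affect
  the value.\<close>

lemma truth_bracketing: "bracketing i j \<xi> \<Longrightarrow> truth v \<xi> \<longleftrightarrow> (\<exists>l\<in>{i..j}. v l)"
proof (induction rule: bracketing.induct)
  case (split i k j \<psi> \<phi>)
  then have "{i..j} = {i..k} \<union> {k+1..j}" by auto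
  with split show ?case by (auto simp: mimp2_def)
qed simp

lemma bracketing_refl: "{\<xi>. bracketing i i \<xi>} = {Var i}"
  by (auto elim: bracketing.cases intro: bracketing.single)

lemma bracketing_MImp_iff:
  "bracketing i j (\<psi> \<leftharpoonup> \<phi>) \<longleftrightarrow> (\<exists>k\<in>{i..<j}. bracketing i k \<psi> \<and> bracketing (k + 1) j \<phi>)"
  by (subst bracketing.simps) auto

text \<open>The formula does not record the split position, but \<open>size\<close> counts
  connectives, so the left part together with \<open>i\<close> determines \<open>k\<close>. The
  extra component \<open>v\<close>, of arbitrary type, lets the same fact serve for counting
  formulae (with \<open>()\<close>) and rows (with valuations).\<close>

lemma inj_on_MImp:
  "inj_on (\<lambda>((k, \<psi>, \<phi>), v). (\<psi> \<leftharpoonup> \<phi>, v))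
     ((SIGMA k:{i..<j}. {\<psi>. bracketing i k \<psi>} \<times> {\<phi>. bracketing (k + 1) j \<phi>}) \<times> UNIV)"
proof -
  have "k = k'" if "bracketing i k \<psi>" "bracketing i k' \<psi>" for k k' \<psi>
    using bracketing_size[OF that(1)] bracketing_size[OF that(2)] by linarith
  then show ?thesis by (auto simp: inj_on_def)
qed

text \<open>Decomposing at the outermost connective gives the Catalan recurrence, so the value is
  the Catalan number of index \<open>j - i\<close>; the argument \<open>Suc (j - i)\<close> is the
  number of variables. Finiteness is carried through the induction because the cardinality of the
  disjoint union depends on it.\<close>

lemma bracketing_finite_card:
  assumes "i \<le> j"
  shows "finite {\<xi>. bracketing i j \<xi>} \<and>
    real (card {\<xi>. bracketing i j \<xi>}) = - sqrt_coeff (Suc (j - i)) / 2"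
  using assms
proof (induction "j - i" arbitrary: i j rule: less_induct)
  case less
  show ?case
  proof (cases "i = j")
    case True
    then show ?thesis by (simp add: bracketing_refl)
  next
    case False
    with less.prems have "i < j" by simp
    define B where "B i j = {\<xi>. bracketing i j \<xi>}" for i j
    have fin: "finite (B i k)" "finite (B (Suc k) j)"
      and card: "real (card (B i k)) = - sqrt_coeff (Suc (k - i)) / 2"
        "real (card (B (Suc k) j)) = - sqrt_coeff (j - k) / 2"
      if "k \<in> {i..<j}" for k
      using less.hyps[of k i] less.hyps[of j "Suc k"] that
      by (auto simp: B_def Suc_diff_Suc)
    let ?S = "SIGMA k:{i..<j}. B i k \<times> B (k + 1) j"
    let ?f = "\<lambda>(k::nat, \<psi>, \<phi>). \<psi> \<leftharpoonup> \<phi>"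
    have eq: "B i j = ?f ` ?S"
    proof (intro set_eqI)
      fix \<xi> show "\<xi> \<in> B i j \<longleftrightarrow> \<xi> \<in> ?f ` ?S"
      proof (cases \<xi>)
        case (Var l)
        then show ?thesis using \<open>i < j\<close> by (auto simp: B_def elim: bracketing.cases)
      next
        case (MImp \<psi> \<phi>)
        then show ?thesis by (force simp: B_def bracketing_MImp_iff)
      qed
    qed
    have inj: "inj_on ?f ?S"
    proof (rule inj_onI)
      fix x y assume "x \<in> ?S" "y \<in> ?S" "?f x = ?f y"
      then show "x = y"
        using inj_onD[OF inj_on_MImp[of i j], of "(x, ())" "(y, ())"]
        by (auto simp: B_def split: prod.splits)
    qed
    have "real (card (B i j)) = (\<Sum>k\<in>{i..<j}. real (card (B i k)) * real (card (B (Suc k) j)))"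
      unfolding eq using fin
      by (subst card_image[OF inj]) (simp add: card_cartesian_product)
    also have "\<dots> = (\<Sum>k\<in>{i..<j}. sqrt_coeff (Suc (k - i)) * sqrt_coeff (j - k)) / 4"
      by (simp add: card sum_divide_distrib)
    \<comment> \<open>The new index is the number of variables in the left part instead of its last
      position.\<close>
    also have "(\<Sum>k\<in>{i..<j}. sqrt_coeff (Suc (k - i)) * sqrt_coeff (j - k)) =
        (\<Sum>k\<in>{1..<Suc (j - i)}. sqrt_coeff k * sqrt_coeff (Suc (j - i) - k))"
      using \<open>i < j\<close>
      by (intro sum.reindex_bij_witness[of _ "\<lambda>k. k + i - 1" "\<lambda>k. Suc k - i"])
        (auto simp: Suc_diff_le)
    also have "\<dots> = -2 * sqrt_coeff (Suc (j - i))"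
      using \<open>i < j\<close> by (intro sqrt_coeff_convolution_inner) simp
    finally have "real (card (B i j)) = - sqrt_coeff (Suc (j - i)) / 2"
      by simp
    moreover have "finite (B i j)"
      unfolding eq using fin by (intro finite_imageI finite_SigmaI) auto
    ultimately show ?thesis by (simp add: B_def)
  qed
qed

section \<open>Counting valuations for a fixed split\<close>

lemma card_valuations_false_on:
  assumes "A \<subseteq> {1..n::nat}"
  shows "card {v \<in> {1..n} \<rightarrow>\<^sub>E (UNIV :: bool set). \<forall>i\<in>A. \<not> v i} = 2 ^ (n - card A)"
proof -
  have "{v \<in> {1..n} \<rightarrow>\<^sub>E (UNIV :: bool set). \<forall>i\<in>A. \<not> v i} =
      (\<Pi>\<^sub>E i\<in>{1..n}. if i \<in> A then {False} else UNIV)" (is "_ = ?R")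
  proof -
    have "(\<forall>i\<in>A. \<not> v i) \<longleftrightarrow> (\<forall>i\<in>{1..n}. v i \<in> (if i \<in> A then {False} else UNIV))"
      for v :: "nat \<Rightarrow> bool" using assms by auto
    then show ?thesis by (simp add: set_eq_iff PiE_iff) blast
  qed
  moreover have "card ?R = (\<Prod>i\<in>{1..n}. if i \<in> A then 1 else 2)"
    by (subst card_PiE) (auto intro!: prod.cong)
  moreover have "\<dots> = 2 ^ card ({1..n} - A)"
    by (simp add: prod.If_cases Diff_eq)
  moreover have "card ({1..n} - A) = n - card A"
    using assms by (simp add: card_Diff_subset finite_subset)
  ultimately show ?thesis by simp
qed

text \<open>Inclusion-exclusion on the complement: one of the two blocks is entirely false, and both
  are so only for the all-false valuation.\<close>

lemma card_valuations_both_true: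
  assumes "k \<le> n"
  shows "real (card {v \<in> {1..n} \<rightarrow>\<^sub>E (UNIV :: bool set).
      (\<exists>i\<in>{1..k}. v i) \<and> (\<exists>i\<in>{k+1..n}. v i)}) = (2 ^ k - 1) * (2 ^ (n - k) - 1)"
proof -
  define F where "F A = {v \<in> {1..n} \<rightarrow>\<^sub>E (UNIV :: bool set). \<forall>i\<in>A. \<not> v i}" for A
  define V where "V = {v \<in> {1..n} \<rightarrow>\<^sub>E (UNIV :: bool set).
      (\<exists>i\<in>{1..k}. v i) \<and> (\<exists>i\<in>{k+1..n}. v i)}"
  have cF: "card (F A) = 2 ^ (n - card A)" if "A \<subseteq> {1..n}" for A
    unfolding F_def using that by (rule card_valuations_false_on)
  have fin: "finite (F A)" for A
    unfolding F_def by (rule finite_subset[of _ "{1..n} \<rightarrow>\<^sub>E UNIV"]) (auto intro!: finite_PiE)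
  have union: "F {} = V \<union> (F {1..k} \<union> F {k+1..n})" by (auto simp: F_def V_def)
  have finV: "finite V" by (rule finite_subset[OF _ fin[of "{}"]]) (auto simp: F_def V_def)
  have "V \<inter> (F {1..k} \<union> F {k+1..n}) = {}" by (auto simp: F_def V_def)
  from card_Un_disjoint[OF finV finite_UnI[OF fin fin] this]
  have "card (F {}) = card V + card (F {1..k} \<union> F {k+1..n})"
    by (simp only: union)
  moreover have "card (F {1..k}) + card (F {k+1..n}) =
      card (F {1..k} \<union> F {k+1..n}) + card (F {1..k} \<inter> F {k+1..n})"
    by (rule card_Un_Int[OF fin fin])
  moreover have "card (F {1..k} \<inter> F {k+1..n}) = card (F {1..n})"
  proof -
    have "F A \<inter> F B = F (A \<union> B)" for A B by (auto simp: F_def)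
    moreover have "{1..k} \<union> {k+1..n} = {1..n}" using assms by auto
    ultimately show ?thesis by (simp only:)
  qed
  moreover have "card (F {}) = 2 ^ n" "card (F {1..k}) = 2 ^ (n - k)"
      "card (F {k+1..n}) = 2 ^ k" "card (F {1..n}) = 1"
    using assms cF[of "{}"] cF[of "{1..k}"] cF[of "{k+1..n}"] cF[of "{1..n}"] by auto
  \<comment> \<open>The additive form avoids truncated subtraction on naturals; over the reals the
    identity factorises into the claimed product.\<close>
  ultimately have "card V + 2 ^ (n - k) + 2 ^ k = 2 ^ n + 1" by linarith
  then have "real (card V + 2 ^ (n - k) + 2 ^ k) = real (2 ^ n + 1)" by (simp only:)
  moreover have "(2::real) ^ n = 2 ^ k * 2 ^ (n - k)"
    using assms by (simp flip: power_add)
  ultimately show ?thesis by (simp add: V_def algebra_simps)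
qed

section \<open>The count of rows as a convolution\<close>

lemma k_case1_sum:
  "real (k_case1 n) = (\<Sum>k\<in>{1..<n}.
    sqrt_coeff k * sqrt_coeff (n - k) / 4 * ((2 ^ k - 1) * (2 ^ (n - k) - 1)))"
proof -
  define B where "B i j = {\<xi>. bracketing i j \<xi>}" for i j
  define V where "V k = {v \<in> {1..n} \<rightarrow>\<^sub>E (UNIV :: bool set).
      (\<exists>i\<in>{1..k}. v i) \<and> (\<exists>i\<in>{k+1..n}. v i)}" for k
  have finV: "finite (V k)" for k
    unfolding V_def by (rule finite_subset[of _ "{1..n} \<rightarrow>\<^sub>E UNIV"]) (auto intro!: finite_PiE)
  have fin: "finite (B 1 k)" "finite (B (Suc k) n)"
    and card: "real (card (B 1 k)) = - sqrt_coeff k / 2"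
      "real (card (B (Suc k) n)) = - sqrt_coeff (n - k) / 2"
    if "k \<in> {1..<n}" for k
    using bracketing_finite_card[of 1 k] bracketing_finite_card[of "Suc k" n] that
    by (auto simp: B_def Suc_diff_Suc)
  \<comment> \<open>A row of case 1 is a split position, two bracketings and a valuation true
    somewhere in each block. The admissible valuations depend on \<open>k\<close> alone, so each
    summand is a product of three cardinalities.\<close>
  let ?S = "SIGMA k:{1..<n}. (B 1 k \<times> B (k + 1) n) \<times> V k"
  let ?f = "\<lambda>(k::nat, (\<psi>, \<phi>), v::nat \<Rightarrow> bool). (\<psi> \<leftharpoonup> \<phi>, v)"
  have eq: "{(\<xi>, v) \<in> Defs.rows n. \<exists>\<psi> \<phi>. \<xi> = \<psi> \<leftharpoonup> \<phi> \<and> truth v \<psi> \<and> truth v \<phi>} = ?f ` ?S"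
    (is "?L = _")
  proof (intro set_eqI)
    fix x show "x \<in> ?L \<longleftrightarrow> x \<in> ?f ` ?S"
    proof (cases x)
      case (Pair \<xi> v)
      show ?thesis
      proof (cases \<xi>)
        case (Var l)
        then show ?thesis using Pair by auto
      next
        case (MImp \<psi> \<phi>)
        have "x \<in> ?L \<longleftrightarrow> v \<in> {1..n} \<rightarrow>\<^sub>E UNIV \<and>
            (\<exists>k\<in>{1..<n}. bracketing 1 k \<psi> \<and> bracketing (k + 1) n \<phi>) \<and> truth v \<psi> \<and> truth v \<phi>"
          by (auto simp: Pair MImp Defs.rows_def bracketing_MImp_iff)
        also have "\<dots> \<longleftrightarrow> (\<exists>k\<in>{1..<n}. \<psi> \<in> B 1 k \<and> \<phi> \<in> B (k + 1) n \<and> v \<in> V k)"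
        proof -
          have "truth v \<psi> \<and> truth v \<phi> \<longleftrightarrow> (\<exists>i\<in>{1..k}. v i) \<and> (\<exists>i\<in>{k+1..n}. v i)"
            if "bracketing 1 k \<psi>" "bracketing (k + 1) n \<phi>" for k
            by (simp only: truth_bracketing[OF that(1)] truth_bracketing[OF that(2)])
          then have "(\<psi> \<in> B 1 k \<and> \<phi> \<in> B (k + 1) n \<and> v \<in> V k) \<longleftrightarrow> v \<in> {1..n} \<rightarrow>\<^sub>E UNIV \<and>
              bracketing 1 k \<psi> \<and> bracketing (k + 1) n \<phi> \<and> truth v \<psi> \<and> truth v \<phi>" for k
            unfolding B_def V_def mem_Collect_eq by metis
          then show ?thesis by blast
        qed
        also have "\<dots> \<longleftrightarrow> x \<in> ?f ` ?S"
          by (force simp: Pair MImp)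
        finally show ?thesis .
      qed
    qed
  qed
  have inj: "inj_on ?f ?S"
  proof (rule inj_onI)
    fix x y assume *: "x \<in> ?S" "y \<in> ?S" "?f x = ?f y"
    obtain k \<psi> \<phi> v k' \<psi>' \<phi>' v' where "x = (k, (\<psi>, \<phi>), v)" "y = (k', (\<psi>', \<phi>'), v')"
      by (metis prod.collapse)
    with * show "x = y"
      using inj_onD[OF inj_on_MImp[of 1 n], of "((k, \<psi>, \<phi>), v)" "((k', \<psi>', \<phi>'), v')"]
      by (auto simp: B_def)
  qed
  have "real (k_case1 n) =
      (\<Sum>k\<in>{1..<n}. real (card (B 1 k)) * real (card (B (Suc k) n)) * real (card (V k)))"
    unfolding k_case1_def eq using fin finV
    by (subst card_image[OF inj]) (simp add: card_cartesian_product)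
  also have "\<dots> = (\<Sum>k\<in>{1..<n}.
      sqrt_coeff k * sqrt_coeff (n - k) / 4 * ((2 ^ k - 1) * (2 ^ (n - k) - 1)))"
    using card_valuations_both_true[of _ n] by (intro sum.cong) (simp_all add: card[simplified] V_def)
  finally show ?thesis .
qed

text \<open>Expanding the product of the two powers leaves \<open>2 ^ n + 1\<close> times the plain
  convolution, which vanishes, and two weighted sums that are mirror images of each other.\<close>

lemma k_case1_convolution:
  assumes "n \<ge> 2"
  shows "real (k_case1 n) = - (\<Sum>k\<le>n. sqrt_coeff k * (2 ^ (n - k) * sqrt_coeff (n - k))) / 2"
proof -
  let ?c = "\<lambda>k. sqrt_coeff k * sqrt_coeff (n - k)"
  let ?D = "\<Sum>k\<le>n. ?c k * 2 ^ (n - k)"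
  have D': "(\<Sum>k\<le>n. ?c k * 2 ^ k) = ?D"
    by (rule sum.reindex_bij_witness[of _ "\<lambda>k. n - k" "\<lambda>k. n - k"]) (auto simp: mult_ac)
  \<comment> \<open>The end terms may be added since each contains the factor
    \<open>2 ^ 0 - 1\<close>.\<close>
  have "real (k_case1 n) = (\<Sum>k\<le>n. ?c k / 4 * ((2 ^ k - 1) * (2 ^ (n - k) - 1)))"
    using assms by (simp add: k_case1_sum sum_atMost_ends)
  also have "\<dots> = (\<Sum>k\<le>n. ((2 ^ n + 1) * ?c k - ?c k * 2 ^ k - ?c k * 2 ^ (n - k)) / 4)"
  proof (intro sum.cong refl)
    fix k assume "k \<in> {..n}"
    then have "(2::real) ^ n = 2 ^ k * 2 ^ (n - k)" by (simp flip: power_add)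
    then show "?c k / 4 * ((2 ^ k - 1) * (2 ^ (n - k) - 1)) =
        ((2 ^ n + 1) * ?c k - ?c k * 2 ^ k - ?c k * 2 ^ (n - k)) / 4"
      by (simp add: algebra_simps)
  qed
  also have "\<dots> = ((2 ^ n + 1) * (\<Sum>k\<le>n. ?c k) - (\<Sum>k\<le>n. ?c k * 2 ^ k) - ?D) / 4"
    by (simp only: sum_subtractf sum_distrib_left flip: sum_divide_distrib)
  also have "\<dots> = - ?D / 2"
    using sqrt_coeff_convolution[OF assms] D' by simp
  finally show ?thesis by (simp add: mult_ac)
qed

section \<open>Growth of the coefficients\<close>

lemma sqrt_coeff_asymp:
  "(\<lambda>n. - sqrt_coeff n / 2) \<sim>[at_top] (\<lambda>n. 4 ^ n / (4 * sqrt (pi * real n ^ 3)))"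
proof (rule asymp_equivI')
  \<comment> \<open>The asymptotics of \<open>(1/2) gchoose n\<close> involve Gamma at
    \<open>-1/2\<close>. As this is not a pole, the functional equation reduces it to the known
    value at \<open>1/2\<close>.\<close>
  have "(-1/2 :: real) \<notin> \<int>\<^sub>\<le>\<^sub>0"
  proof
    assume "(-1/2 :: real) \<in> \<int>\<^sub>\<le>\<^sub>0"
    then obtain m where "-1/2 = real_of_int m" by (rule nonpos_Ints_cases)
    then have "real_of_int (2 * m) = real_of_int (-1)" by simp
    then have "2 * m = -1" by (simp only: of_int_eq_iff)
    then show False by presburger
  qed
  then have "Gamma (-1/2 + 1) = (-1/2) * Gamma (-1/2 :: real)"
    by (rule Gamma_plus1)
  then have G: "Gamma (-1/2 :: real) = -2 * sqrt pi"
    by (simp add: Gamma_one_half_real)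
  have "(\<lambda>n. ((1/2) gchoose n) / ((-1)^n / exp ((1/2+1) * ln (real n)))) \<longlonglongrightarrow>
      inverse (-2 * sqrt pi)"
    using gbinomial_asymptotic[of "1/2::real"] G by simp
  then have "(\<lambda>n. ((1/2) gchoose n) / ((-1)^n / exp ((1/2+1) * ln (real n))) * (-2 * sqrt pi))
      \<longlonglongrightarrow> inverse (-2 * sqrt pi) * (-2 * sqrt pi)"
    by (rule tendsto_mult_right)
  then have lim: "(\<lambda>n. ((1/2) gchoose n) / ((-1)^n / exp ((1/2+1) * ln (real n))) * (-2 * sqrt pi))
      \<longlonglongrightarrow> 1"
    by simp
  show "(\<lambda>n. - sqrt_coeff n / 2 / (4 ^ n / (4 * sqrt (pi * real n ^ 3)))) \<longlonglongrightarrow> 1"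
  proof (rule Lim_transform_eventually[OF lim])
    show "\<forall>\<^sub>F n in sequentially.
        ((1/2) gchoose n) / ((-1)^n / exp ((1/2+1) * ln (real n))) * (-2 * sqrt pi) =
        - sqrt_coeff n / 2 / (4 ^ n / (4 * sqrt (pi * real n ^ 3)))"
      using eventually_gt_at_top[of 0]
    proof eventually_elim
      case (elim n)
      have "exp ((1/2+1) * ln (real n)) = real n powr (1 + 1/2)"
        using elim by (simp add: powr_def)
      also have "\<dots> = real n * sqrt (real n)"
        by (simp only: powr_add powr_one powr_half_sqrt of_nat_0_le_iff)
      finally have e: "exp ((1/2+1) * ln (real n)) = real n * sqrt (real n)" .
      have s: "sqrt (pi * real n ^ 3) = sqrt pi * (real n * sqrt (real n))"
        using elim by (simp add: real_sqrt_mult power3_eq_cube)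
      have p: "(-4::real) ^ n = (-1) ^ n * 4 ^ n"
        by (simp flip: power_mult_distrib)
      \<comment> \<open>The alternating sign of the binomial coefficient cancels against that of
        \<open>(-4) ^ n\<close>.\<close>
      have "(-1::real) ^ n * (-1) ^ n = 1"
        by (simp flip: power_mult_distrib)
      then have q: "x / ((-1) ^ n / y) = x * (-1) ^ n * y" for x y :: real
        by (simp add: divide_simps)
      show ?case
        unfolding e s sqrt_coeff_def p q by simp
    qed
  qed
qed

text \<open>Consecutive ratios tend to \<open>1/4\<close> by the recurrence, and \<open>k\<close> of
  them are multiplied. This yields the termwise limits of the normalised convolution.\<close>

lemma sqrt_coeff_ratio_tendsto:
  "(\<lambda>n. sqrt_coeff n / sqrt_coeff (n + k)) \<longlonglongrightarrow> (1/4) ^ k"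
proof (induction k)
  case 0
  then show ?case by (simp add: sqrt_coeff_nonzero)
next
  case (Suc k)
  have "(\<lambda>n. (real (n + k) + 1) / (4 * real (n + k) - 2)) \<longlonglongrightarrow> 1/4"
    unfolding of_nat_add by real_asymp
  from tendsto_mult[OF Suc this]
  have "(\<lambda>n. sqrt_coeff n / sqrt_coeff (n + k) *
      ((real (n + k) + 1) / (4 * real (n + k) - 2))) \<longlonglongrightarrow> (1/4) ^ Suc k"
    by (simp add: mult.commute)
  then show ?case
    by (simp add: sqrt_coeff_Suc field_simps)
qed

lemma abs_sqrt_coeff_le: "\<bar>sqrt_coeff n\<bar> \<le> 4 ^ n"
proof (induction n)
  case (Suc n)
  have "\<bar>(4 * real n - 2) / (real n + 1)\<bar> \<le> 4"
    by (simp add: abs_le_iff divide_simps)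
  with Suc show ?case
    unfolding sqrt_coeff_Suc abs_mult power_Suc by (intro mult_mono) auto
qed simp

text \<open>The weight \<open>n^2\<close> overcompensates the decay \<open>n powr (-3/2)\<close>; the resulting monotonicity
  gives the dominating sequence for Tannery's theorem.\<close>

lemma incseq_sqrt_coeff: "incseq (\<lambda>n. real n ^ 2 * (\<bar>sqrt_coeff n\<bar> / 4 ^ n))"
proof (rule incseq_SucI)
  fix n
  show "real n ^ 2 * (\<bar>sqrt_coeff n\<bar> / 4 ^ n) \<le>
      real (Suc n) ^ 2 * (\<bar>sqrt_coeff (Suc n)\<bar> / 4 ^ Suc n)"
  proof (cases n)
    case (Suc m)
    let ?c = "\<bar>sqrt_coeff n\<bar> / 4 ^ n"
    have n: "real n \<ge> 1" using Suc by simp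
    have r: "\<bar>sqrt_coeff (Suc n)\<bar> = (4 * real n - 2) / (real n + 1) * \<bar>sqrt_coeff n\<bar>"
      using n by (simp add: sqrt_coeff_Suc abs_mult)
    have "real (Suc n) ^ 2 * (\<bar>sqrt_coeff (Suc n)\<bar> / 4 ^ Suc n) =
        (real n + 1) * ((4 * real n - 2) / 4) * ?c"
      unfolding r by (simp add: power2_eq_square divide_simps) (simp add: algebra_simps)
    \<comment> \<open>The right side is \<open>n^2 + (n - 1)/2\<close>, so \<open>n \<ge> 1\<close>
      is exactly what is needed.\<close>
    moreover have le: "real n ^ 2 \<le> (real n + 1) * ((4 * real n - 2) / 4)"
      using n by (simp add: power2_eq_square field_simps)
    moreover from le have "real n ^ 2 * ?c \<le> (real n + 1) * ((4 * real n - 2) / 4) * ?c"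
      by (rule mult_right_mono) simp
    ultimately show ?thesis by linarith
  qed simp
qed

text \<open>With \<open>m = n - k \<ge> 1\<close>, monotonicity bounds the ratio by
  \<open>(n/m)^2\<close>, and \<open>m + k \<le> m * (k + 1)\<close> makes this independent of
  \<open>n\<close>. For \<open>k = n\<close> the weight \<open>m^2\<close> is zero, so the
  comparison starts at index 1, where \<open>\<bar>sqrt_coeff 1\<bar> / 4 = 1/2\<close>; hence the
  factor 2.\<close>

lemma abs_sqrt_coeff_diff_le:
  assumes "k \<le> n" "n \<ge> 1"
  shows "\<bar>sqrt_coeff (n - k)\<bar> * 4 ^ k \<le> 2 * (real k + 1) ^ 2 * \<bar>sqrt_coeff n\<bar>"
proof (cases "k = n")
  case True
  have "1 ^ 2 * (\<bar>sqrt_coeff 1\<bar> / 4 ^ 1) \<le> real n ^ 2 * (\<bar>sqrt_coeff n\<bar> / 4 ^ n)"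
    using incseqD[OF incseq_sqrt_coeff assms(2)] by simp
  then have "4 ^ n \<le> 2 * real n ^ 2 * \<bar>sqrt_coeff n\<bar>"
    by (simp add: field_simps)
  also have "\<dots> \<le> 2 * (real n + 1) ^ 2 * \<bar>sqrt_coeff n\<bar>"
    by (intro mult_right_mono mult_left_mono power_mono) auto
  finally show ?thesis using True by simp
next
  case False
  define m where "m = n - k"
  have m: "m \<ge> 1" "n = m + k" using False assms by (auto simp: m_def)
  have "real m ^ 2 * (\<bar>sqrt_coeff m\<bar> / 4 ^ m) \<le> real n ^ 2 * (\<bar>sqrt_coeff n\<bar> / 4 ^ n)"
    using incseqD[OF incseq_sqrt_coeff, of m n] m by simp
  then have "real m ^ 2 * (\<bar>sqrt_coeff m\<bar> * 4 ^ k) \<le> real n ^ 2 * \<bar>sqrt_coeff n\<bar>"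
    by (simp add: m(2) power_add field_simps)
  also have "\<dots> \<le> (real m * (real k + 1)) ^ 2 * \<bar>sqrt_coeff n\<bar>"
  proof (intro mult_right_mono power_mono)
    have "1 * real k \<le> real m * real k" using m by (intro mult_right_mono) auto
    then show "real n \<le> real m * (real k + 1)" by (simp add: m(2) algebra_simps)
  qed auto
  finally have "real m ^ 2 * (\<bar>sqrt_coeff m\<bar> * 4 ^ k) \<le>
      real m ^ 2 * ((real k + 1) ^ 2 * \<bar>sqrt_coeff n\<bar>)"
    by (simp add: power_mult_distrib mult_ac)
  then have "\<bar>sqrt_coeff m\<bar> * 4 ^ k \<le> (real k + 1) ^ 2 * \<bar>sqrt_coeff n\<bar>"
    using m by simp
  also have "\<dots> \<le> 2 * (real k + 1) ^ 2 * \<bar>sqrt_coeff n\<bar>" by simp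
  finally show ?thesis by (simp add: m_def)
qed

section \<open>Limit of the normalised convolution\<close>

lemma sqrt_coeff_sums: "(\<lambda>k. sqrt_coeff k / 8 ^ k) sums (sqrt 2 / 2)"
proof -
  \<comment> \<open>Evaluation at \<open>x = 1/8\<close> turns the series into the binomial series
    of \<open>sqrt (1 + z)\<close> at \<open>z = -1/2\<close>.\<close>
  have "(-4) ^ k / 8 ^ k = (-1/2 :: real) ^ k" for k
    by (simp flip: power_divide)
  then have "sqrt_coeff k / 8 ^ k = ((1/2) gchoose k) * (-1/2) ^ k" for k
    by (simp only: sqrt_coeff_def flip: times_divide_eq_right)
  moreover have "(\<lambda>k. ((1/2::real) gchoose k) * (-1/2) ^ k) sums sqrt (1 + -1/2)"
    by (rule sqrt_series) simp
  moreover have "sqrt (1 + -1/2) = sqrt 2 / 2"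
    by (simp add: real_sqrt_divide real_div_sqrt field_simps)
  ultimately show ?thesis by (simp only:)
qed

lemma sqrt_coeff_convolution_tendsto:
  "(\<lambda>n. (\<Sum>k\<le>n. sqrt_coeff k * (2 ^ (n - k) * sqrt_coeff (n - k))) / (2 ^ n * sqrt_coeff n))
    \<longlonglongrightarrow> sqrt 2 / 2"
proof -
  \<comment> \<open>Padding with zeros beyond \<open>n\<close> turns the finite sums into infinite
    series over a fixed index set, the form required by Tannery's theorem.\<close>
  define a where "a k n = (if k \<le> n then
      sqrt_coeff k * (2 ^ (n - k) * sqrt_coeff (n - k)) / (2 ^ n * sqrt_coeff n) else 0)" for k n
  \<comment> \<open>The product of three bounds: \<open>4 ^ k\<close> for
    \<open>sqrt_coeff k\<close>, \<open>1 / 2 ^ k\<close> from the powers of two, and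
    \<open>2 * (k + 1)^2 / 4 ^ k\<close> for the quotient of \<open>sqrt_coeff (n - k)\<close> by
    \<open>sqrt_coeff n\<close>.\<close>
  define M where "M k = 2 * (real k + 1) ^ 2 / 2 ^ k" for k :: nat
  have lim: "(\<lambda>n. a k n) \<longlonglongrightarrow> sqrt_coeff k / 8 ^ k" for k
  proof (rule LIMSEQ_offset)
    have "a k (n + k) = sqrt_coeff k / 2 ^ k * (sqrt_coeff n / sqrt_coeff (n + k))" for n
      by (simp add: a_def power_add)
    moreover have "(\<lambda>n. sqrt_coeff k / 2 ^ k * (sqrt_coeff n / sqrt_coeff (n + k)))
        \<longlonglongrightarrow> sqrt_coeff k / 2 ^ k * (1/4) ^ k"
      by (intro tendsto_mult_left sqrt_coeff_ratio_tendsto)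
    moreover have "sqrt_coeff k / 2 ^ k * (1/4) ^ k = sqrt_coeff k / 8 ^ k"
      by (simp add: power_divide flip: power_mult_distrib)
    ultimately show "(\<lambda>n. a k (n + k)) \<longlonglongrightarrow> sqrt_coeff k / 8 ^ k" by simp
  qed
  have bound: "norm (a k n) \<le> M k" if "n \<ge> 1" for k n
  proof (cases "k \<le> n")
    case True
    have "(2::real) ^ n = 2 ^ k * 2 ^ (n - k)" using True by (simp flip: power_add)
    then have "norm (a k n) = \<bar>sqrt_coeff k\<bar> * (\<bar>sqrt_coeff (n - k)\<bar> / \<bar>sqrt_coeff n\<bar>) / 2 ^ k"
      using True by (simp add: a_def abs_mult)
    also have "\<dots> \<le> 4 ^ k * (\<bar>sqrt_coeff (n - k)\<bar> / \<bar>sqrt_coeff n\<bar>) / 2 ^ k"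
      by (intro divide_right_mono mult_right_mono abs_sqrt_coeff_le) auto
    also have "4 ^ k * (\<bar>sqrt_coeff (n - k)\<bar> / \<bar>sqrt_coeff n\<bar>) \<le> 2 * (real k + 1) ^ 2"
      using abs_sqrt_coeff_diff_le[OF True that] sqrt_coeff_nonzero[of n]
      by (simp add: field_simps)
    finally show ?thesis by (simp add: M_def divide_right_mono)
  qed (simp add: a_def M_def)
  have "summable M"
  proof (rule summable_comparison_test_bigo)
    show "summable (\<lambda>k. norm (inverse (real k ^ 2)))"
      by (simp add: inverse_power_summable)
    show "M \<in> O(\<lambda>k. inverse (real k ^ 2))" unfolding M_def by real_asymp
  qed
  moreover have "\<forall>\<^sub>F (k, n) in at_top \<times>\<^sub>F at_top. norm (a k n) \<le> M k"
    using bound eventually_prod_sequentially by blast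
  ultimately have "(\<lambda>n. suminf (\<lambda>k. a k n)) \<longlonglongrightarrow> (\<Sum>k. sqrt_coeff k / 8 ^ k)"
    using lim tannerys_theorem[where a = a and M = M and F = at_top] by simp
  moreover have "suminf (\<lambda>k. a k n) =
      (\<Sum>k\<le>n. sqrt_coeff k * (2 ^ (n - k) * sqrt_coeff (n - k))) / (2 ^ n * sqrt_coeff n)" for n
    by (subst suminf_finite[of "{..n}"]) (auto simp: a_def sum_divide_distrib)
  ultimately show ?thesis
    using sums_unique[OF sqrt_coeff_sums] by simp
qed

section \<open>Asymptotics of the row count\<close>

theorem theorem7p10:
  shows "(\<lambda>n::nat. real (k_case1 n)) \<sim>[at_top]
    (\<lambda>n::nat. (sqrt 2 / 2) * (2 ^ (3 * n - 2) / sqrt (pi * real n ^ 3)))"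
proof -
  let ?q = "\<lambda>n. (\<Sum>k\<le>n. sqrt_coeff k * (2 ^ (n - k) * sqrt_coeff (n - k))) / (2 ^ n * sqrt_coeff n)"
  let ?r = "\<lambda>n. 4 ^ n / (4 * sqrt (pi * real n ^ 3))"
  have "?q \<sim>[at_top] (\<lambda>_. sqrt 2 / 2)"
    using sqrt_coeff_convolution_tendsto asymp_equivI'_const[of ?q "\<lambda>_. 1" "sqrt 2 / 2"] by simp
  then have "(\<lambda>n. ?q n * (2 ^ n * (- sqrt_coeff n / 2))) \<sim>[at_top]
      (\<lambda>n. sqrt 2 / 2 * (2 ^ n * ?r n))"
    by (rule asymp_equiv_mult[OF _ asymp_equiv_mult[OF asymp_equiv_refl sqrt_coeff_asymp]])
  moreover have "\<forall>\<^sub>F n in at_top. ?q n * (2 ^ n * (- sqrt_coeff n / 2)) = real (k_case1 n)"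
    using eventually_ge_at_top[of 2]
    by eventually_elim (simp add: k_case1_convolution sqrt_coeff_nonzero)
  \<comment> \<open>The \<open>4\<close> in the denominator of \<open>?r\<close> accounts for the
    \<open>- 2\<close> in the exponent; \<open>n \<ge> 1\<close> keeps the natural subtraction
    \<open>3 * n - 2\<close> from truncating.\<close>
  moreover have "\<forall>\<^sub>F n in at_top. sqrt 2 / 2 * (2 ^ n * ?r n) =
      (sqrt 2 / 2) * (2 ^ (3 * n - 2) / sqrt (pi * real n ^ 3))"
    using eventually_ge_at_top[of 1]
  proof eventually_elim
    case (elim n)
    have "(2::real) ^ n * 4 ^ n = 2 ^ (n + 2 * n)"
      by (simp only: power_add power_mult) simp
    also have "n + 2 * n = 2 + (3 * n - 2)" using elim by simp
    finally have "(2::real) ^ n * 4 ^ n = 4 * 2 ^ (3 * n - 2)"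
      by (simp add: power_add)
    then have "(2::real) ^ n * ?r n = 2 ^ (3 * n - 2) / sqrt (pi * real n ^ 3)"
      by simp
    then show ?case by simp
  qed
  ultimately show ?thesis
    by (rule asymp_equiv_transfer)
qed

end
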